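(* The reduction relation $\rightarrow_{\beta\pi}$ of $\lambda\mathbf{J}$ is confluent.
   Context: $\lambda\mathbf{J}$: terms $t,u,v::=x\mid\lambda x.t\mid t(u,x.v)$, where $x$ is bound in $v$ (capture-avoiding substitution). A value $V$ is a variable or a $\lambda$-abstraction. Generalised arguments $R,S$ are pairs $(u,x.v)$, and $tRS$ means $(tR)S$. Append: $(u,x.V)@S=(u,x.VS)$ for $V$ a value, and $(u,x.tR')@S=(u,x.t(R'@S))$. The reduction is the closure under all constructors of: $(\beta)\ (\lambda x.t)(u,y.v)\rightarrow[[u/x]t/y]v$ and $(\pi)\ tRS\rightarrow t(R@S)$. Confluence: whenever $t\rightarrow^*t_1$ and $t\rightarrow^*t_2$ there is $t_3$ with $t_i\rightarrow^*t_3$. *)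

theory Defs
  imports "HOL-Library.Confluence"
begin

text \<open>
  Terms up to alpha-equivalence, in de Bruijn notation. \<open>GArg u v\<close> is the generalised argument
  \<open>(u, x.v)\<close>: index 0 of \<open>v\<close> is the bound \<open>x\<close>, whereas \<open>u\<close> lies outside its scope.
\<close>

datatype trm =
    Var nat
  | Lam trm
  | App trm garg
and garg =
    GArg trm trm

primrec is_value :: "trm \<Rightarrow> bool" where
  "is_value (Var i) \<longleftrightarrow> True"
| "is_value (Lam t) \<longleftrightarrow> True"
| "is_value (App t R) \<longleftrightarrow> False"

text \<open>\<open>lift k t\<close> increments the indices of \<open>t\<close> that are at least \<open>k\<close> (weakening at position \<open>k\<close>).\<close>

primrec lift :: "nat \<Rightarrow> trm \<Rightarrow> trm" and lift_arg :: "nat \<Rightarrow> garg \<Rightarrow> garg" where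
  "lift k (Var i) = (if i < k then Var i else Var (Suc i))"
| "lift k (Lam t) = Lam (lift (Suc k) t)"
| "lift k (App t R) = App (lift k t) (lift_arg k R)"
| "lift_arg k (GArg u v) = GArg (lift k u) (lift (Suc k) v)"

text \<open>
  \<open>subst s k t\<close> replaces index \<open>k\<close> in \<open>t\<close> by \<open>s\<close> and decrements the larger indices, the binder of
  \<open>k\<close> having been removed.
\<close>

primrec subst :: "trm \<Rightarrow> nat \<Rightarrow> trm \<Rightarrow> trm" and subst_arg :: "trm \<Rightarrow> nat \<Rightarrow> garg \<Rightarrow> garg" where
  "subst s k (Var i) = (if k < i then Var (i - 1) else if i = k then s else Var i)"
| "subst s k (Lam t) = Lam (subst (lift 0 s) (Suc k) t)"
| "subst s k (App t R) = App (subst s k t) (subst_arg s k R)"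
| "subst_arg s k (GArg u v) = GArg (subst s k u) (subst (lift 0 s) (Suc k) v)"

lemma subst_lift: "subst s k (lift k t) = t"
  and subst_arg_lift_arg: "subst_arg s k (lift_arg k R) = R"
  by (induction t and R arbitrary: s k and s k) auto

text \<open>
  The append \<open>R @ S\<close>. Since \<open>S\<close> moves under the binder of \<open>(u, x.v)\<close>, it is lifted; this renders the
  convention that \<open>x\<close> does not occur free in \<open>S\<close>.
\<close>

fun append_arg :: "garg \<Rightarrow> garg \<Rightarrow> garg" where
  "append_arg (GArg u (Var i)) S = GArg u (App (Var i) (lift_arg 0 S))"
| "append_arg (GArg u (Lam t)) S = GArg u (App (Lam t) (lift_arg 0 S))"
| "append_arg (GArg u (App t R)) S = GArg u (App t (append_arg R (lift_arg 0 S)))"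

lemma append_arg_value:
  "is_value V \<Longrightarrow> append_arg (GArg u V) S = GArg u (App V (lift_arg 0 S))"
  by (cases V) simp_all

inductive beta_root :: "trm \<Rightarrow> trm \<Rightarrow> bool" where
  "beta_root (App (Lam t) (GArg u v)) (subst (subst u 0 t) 0 v)"

inductive pi_root :: "trm \<Rightarrow> trm \<Rightarrow> bool" where
  "pi_root (App (App t R) S) (App t (append_arg R S))"

inductive compatible_closure :: "(trm \<Rightarrow> trm \<Rightarrow> bool) \<Rightarrow> trm \<Rightarrow> trm \<Rightarrow> bool"
  for r :: "trm \<Rightarrow> trm \<Rightarrow> bool" where
  root: "r t t' \<Longrightarrow> compatible_closure r t t'"
| Lam: "compatible_closure r t t' \<Longrightarrow> compatible_closure r (Lam t) (Lam t')"
| App_fun: "compatible_closure r t t' \<Longrightarrow> compatible_closure r (App t R) (App t' R)"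
| App_arg: "compatible_closure r u u' \<Longrightarrow>
    compatible_closure r (App t (GArg u v)) (App t (GArg u' v))"
| App_cont: "compatible_closure r v v' \<Longrightarrow>
    compatible_closure r (App t (GArg u v)) (App t (GArg u v'))"

definition beta_pi :: "trm \<Rightarrow> trm \<Rightarrow> bool" (infix \<open>\<rightarrow>\<^sub>\<beta>\<^sub>\<pi>\<close> 50) where
  "beta_pi = compatible_closure (sup beta_root pi_root)"

end

theory Submission
  imports Defs
begin

text \<open>
  Confluence follows from the Z property: there is a map \<open>*\<close> such that \<open>t \<rightarrow> t'\<close> implies
  \<open>t' \<rightarrow>\<^sup>* t* \<rightarrow>\<^sup>* t'*\<close>. The usual complete development fails because substituting an application
  for the head variable of an application creates \<open>\<pi>\<close>-redexes. Therefore \<open>t*\<close> contracts the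
  \<open>\<beta>\<close>-redexes of \<open>t\<close> and takes the \<open>\<pi>\<close>-normal form of the contractum, and it replaces every
  application of an application by an append.
\<close>

text \<open>The second predicate of the mutual induction is fixed to be \<open>P\<close> on both
  components of an argument, so single-predicate inductions suffice below.\<close>

lemma trm_induct [case_names Var Lam App]:
  assumes "\<And>i. P (Var i)" and "\<And>t. P t \<Longrightarrow> P (Lam t)"
    and "\<And>t u v. P t \<Longrightarrow> P u \<Longrightarrow> P v \<Longrightarrow> P (App t (GArg u v))"
  shows "P t"
proof -
  have "P t" and "case R of GArg u v \<Rightarrow> P u \<and> P v" for R
    by (induction t and R) (auto intro: assms split: garg.splits)
  then show ?thesis by simp
qed

text \<open>The map \<open>f\<close> is monotone for many-step reduction. If a peak from
  \<open>a\<close> has \<open>b\<close> on one side and ends in \<open>c' \<rightarrow> c\<close> on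
  the other, then \<open>f c'\<close> joins it, via \<open>b\<close>, \<open>f a\<close>,
  \<open>f c'\<close> and directly from \<open>c\<close>.\<close>

lemma Z_imp_confluentp:
  assumes Z: "\<And>a b. r a b \<Longrightarrow> r\<^sup>*\<^sup>* b (f a) \<and> r\<^sup>*\<^sup>* (f a) (f b)"
  shows "confluentp r"
proof -
  have mono: "r\<^sup>*\<^sup>* (f a) (f b)" if "r\<^sup>*\<^sup>* a b" for a b
    using that by induction (auto dest: Z intro: rtranclp_trans)
  have "\<exists>d. r\<^sup>*\<^sup>* b d \<and> r\<^sup>*\<^sup>* c d" if "r a b" "r\<^sup>*\<^sup>* a c" for a b c
    using that(2)
  proof (cases rule: rtranclp.cases)
    case rtrancl_refl
    then show ?thesis using that(1) by blast
  next
    case (rtrancl_into_rtrancl c')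
    have "r\<^sup>*\<^sup>* b (f c')"
      using Z[OF that(1)] mono[OF rtrancl_into_rtrancl(1)] by (meson rtranclp_trans)
    then show ?thesis using Z[OF rtrancl_into_rtrancl(2)] by blast
  qed
  then have "semiconfluentp r" by (rule semiconfluentpI)
  then show ?thesis by (rule semiconfluentp_imp_confluentp)
qed


section \<open>Append, lifting and substitution\<close>

text \<open>Application up to a root \<open>\<pi>\<close>-step, which is contracted at once. It
  turns the case distinction in \<open>append_arg\<close> into the single equation
  \<open>append_arg_GArg\<close>.\<close>

primrec appl :: "trm \<Rightarrow> garg \<Rightarrow> trm" where
  "appl (Var i) S = App (Var i) S"
| "appl (Lam t) S = App (Lam t) S"
| "appl (App t R) S = App t (append_arg R S)"

lemma append_arg_GArg [simp]: "append_arg (GArg u v) S = GArg u (appl v (lift_arg 0 S))"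
  by (cases v) simp_all

declare append_arg.simps [simp del]

lemma lift_lift: "i \<le> k \<Longrightarrow> lift (Suc k) (lift i t) = lift i (lift k t)"
  by (induction t arbitrary: i k rule: trm_induct) auto

lemma lift_arg_lift_arg: "i \<le> k \<Longrightarrow> lift_arg (Suc k) (lift_arg i R) = lift_arg i (lift_arg k R)"
  by (cases R) (simp add: lift_lift)

lemma lift_appl: "lift k (appl t S) = appl (lift k t) (lift_arg k S)"
  by (induction t arbitrary: k S rule: trm_induct) (auto simp: lift_arg_lift_arg)

lemma lift_append_arg: "lift_arg k (append_arg R S) = append_arg (lift_arg k R) (lift_arg k S)"
  by (cases R) (simp add: lift_appl lift_arg_lift_arg)

lemma appl_appl: "appl (appl t R) S = appl t (append_arg R S)"
proof (induction t arbitrary: R S rule: trm_induct)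
  case (App t u v)
  then show ?case by (cases R) (simp add: lift_appl lift_arg_lift_arg)
qed auto

lemma append_arg_assoc: "append_arg (append_arg R S) T = append_arg R (append_arg S T)"
  by (cases R) (simp add: appl_appl lift_append_arg)

lemma lift_subst:
  "i \<le> k \<Longrightarrow> lift k (subst s i t) = subst (lift k s) i (lift (Suc k) t)"
  by (induction t arbitrary: s i k rule: trm_induct) (auto simp: lift_lift)

lemma lift_subst_le:
  "i \<le> k \<Longrightarrow> lift i (subst s k t) = subst (lift i s) (Suc k) (lift i t)"
  by (induction t arbitrary: s i k rule: trm_induct) (auto simp: lift_lift)

lemma lift_arg_subst_arg_le:
  "i \<le> k \<Longrightarrow> lift_arg i (subst_arg s k R) = subst_arg (lift i s) (Suc k) (lift_arg i R)"
  by (cases R) (auto simp: lift_subst_le lift_lift)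

lemma subst_subst:
  "i \<le> k \<Longrightarrow> subst s k (subst w i t) = subst (subst s k w) i (subst (lift i s) (Suc k) t)"
  by (induction t arbitrary: s w i k rule: trm_induct)
    (auto simp: lift_lift lift_subst_le subst_lift)


section \<open>\<open>\<pi>\<close>-normal forms\<close>

text \<open>One bottom-up pass suffices, because \<open>appl\<close> creates no
  \<open>\<pi>\<close>-redex when both of its inputs are \<open>\<pi>\<close>-normal.\<close>

primrec nf :: "trm \<Rightarrow> trm" and nf_arg :: "garg \<Rightarrow> garg" where
  "nf (Var i) = Var i"
| "nf (Lam t) = Lam (nf t)"
| "nf (App t R) = appl (nf t) (nf_arg R)"
| "nf_arg (GArg u v) = GArg (nf u) (nf v)"

lemma lift_nf: "lift k (nf t) = nf (lift k t)"
  by (induction t arbitrary: k rule: trm_induct) (auto simp: lift_appl)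

lemma lift_arg_nf_arg: "lift_arg k (nf_arg R) = nf_arg (lift_arg k R)"
  by (cases R) (simp add: lift_nf)

lemma nf_appl: "nf (appl t S) = appl (nf t) (nf_arg S)"
proof (induction t arbitrary: S rule: trm_induct)
  case (App t u v)
  then show ?case by (simp add: appl_appl lift_arg_nf_arg)
qed auto

lemma nf_nf [simp]: "nf (nf t) = nf t"
  by (induction t rule: trm_induct) (auto simp: nf_appl)

text \<open>Substitution alone does not commute with \<open>appl\<close>: an application put for a
  head variable creates a \<open>\<pi>\<close>-redex. The outer \<open>nf\<close> removes
  it.\<close>

lemma nf_subst_appl:
  "nf (subst s k (appl t S)) = appl (nf (subst s k t)) (nf_arg (subst_arg s k S))"
proof (induction t arbitrary: s k S rule: trm_induct)
  case (App t u v)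
  then show ?case
    by (simp add: appl_appl lift_arg_nf_arg lift_arg_subst_arg_le)
qed auto

lemma nf_subst_nf_right: "nf (subst s k (nf t)) = nf (subst s k t)"
  by (induction t arbitrary: s k rule: trm_induct) (auto simp: nf_subst_appl)

lemma nf_subst_nf_left: "nf (subst (nf s) k t) = nf (subst s k t)"
  by (induction t arbitrary: s k rule: trm_induct) (auto simp: lift_nf)


section \<open>Closure properties of the reduction\<close>

abbreviation beta_pi_steps :: "trm \<Rightarrow> trm \<Rightarrow> bool" (infix \<open>\<rightarrow>*\<close> 50) where
  "beta_pi_steps \<equiv> beta_pi\<^sup>*\<^sup>*"

lemma beta_pi_induct [consumes 1, case_names beta pi Lam App_fun App_arg App_cont]:
  assumes "a \<rightarrow>\<^sub>\<beta>\<^sub>\<pi> b"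
    and "\<And>t u v. P (App (Lam t) (GArg u v)) (subst (subst u 0 t) 0 v)"
    and "\<And>t R S. P (App (App t R) S) (App t (append_arg R S))"
    and "\<And>t t'. t \<rightarrow>\<^sub>\<beta>\<^sub>\<pi> t' \<Longrightarrow> P t t' \<Longrightarrow> P (Lam t) (Lam t')"
    and "\<And>t t' u v. t \<rightarrow>\<^sub>\<beta>\<^sub>\<pi> t' \<Longrightarrow> P t t' \<Longrightarrow> P (App t (GArg u v)) (App t' (GArg u v))"
    and "\<And>t u u' v. u \<rightarrow>\<^sub>\<beta>\<^sub>\<pi> u' \<Longrightarrow> P u u' \<Longrightarrow> P (App t (GArg u v)) (App t (GArg u' v))"
    and "\<And>t u v v'. v \<rightarrow>\<^sub>\<beta>\<^sub>\<pi> v' \<Longrightarrow> P v v' \<Longrightarrow> P (App t (GArg u v)) (App t (GArg u v'))"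
  shows "P a b"
  using assms(1) unfolding beta_pi_def
proof induction
  case (root t t')
  then show ?case using assms(2,3) by (auto elim: beta_root.cases pi_root.cases)
next
  case (App_fun t t' R)
  then show ?case using assms(5) by (cases R) (auto simp: beta_pi_def)
qed (auto intro: assms simp: beta_pi_def)

lemma beta_step: "App (Lam t) (GArg u v) \<rightarrow>\<^sub>\<beta>\<^sub>\<pi> subst (subst u 0 t) 0 v"
  unfolding beta_pi_def by (auto intro: compatible_closure.root beta_root.intros)

lemma pi_step: "App (App t R) S \<rightarrow>\<^sub>\<beta>\<^sub>\<pi> App t (append_arg R S)"
  unfolding beta_pi_def by (auto intro: compatible_closure.root pi_root.intros)

lemma steps_Lam: "t \<rightarrow>* t' \<Longrightarrow> Lam t \<rightarrow>* Lam t'"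
  by (induction rule: rtranclp_induct)
    (auto simp: beta_pi_def intro: compatible_closure.Lam rtranclp.rtrancl_into_rtrancl)

lemma steps_App:
  assumes "t \<rightarrow>* t'" "u \<rightarrow>* u'" "v \<rightarrow>* v'"
  shows "App t (GArg u v) \<rightarrow>* App t' (GArg u' v')"
proof -
  have "App t (GArg u v) \<rightarrow>* App t' (GArg u v)"
    using assms(1) by (induction rule: rtranclp_induct)
      (auto simp: beta_pi_def intro: compatible_closure.App_fun rtranclp.rtrancl_into_rtrancl)
  also have "\<dots> \<rightarrow>* App t' (GArg u' v)"
    using assms(2) by (induction rule: rtranclp_induct)
      (auto simp: beta_pi_def intro: compatible_closure.App_arg rtranclp.rtrancl_into_rtrancl)
  also have "\<dots> \<rightarrow>* App t' (GArg u' v')"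
    using assms(3) by (induction rule: rtranclp_induct)
      (auto simp: beta_pi_def intro: compatible_closure.App_cont rtranclp.rtrancl_into_rtrancl)
  finally show ?thesis .
qed

lemma App_steps_appl: "App t R \<rightarrow>* appl t R"
  by (cases t) (auto intro: pi_step)

lemma steps_nf: "t \<rightarrow>* nf t"
proof (induction t rule: trm_induct)
  case (App t u v)
  then have "App t (GArg u v) \<rightarrow>* App (nf t) (GArg (nf u) (nf v))" by (rule steps_App)
  also have "\<dots> \<rightarrow>* nf (App t (GArg u v))" using App_steps_appl by simp
  finally show ?case .
qed (auto intro: steps_Lam)

lemma contract_steps:
  "App (Lam t) (GArg u v) \<rightarrow>* nf (subst (subst u 0 t) 0 v)"
  using beta_step steps_nf by (rule converse_rtranclp_into_rtranclp)

lemma steps_lift: "t \<rightarrow>* t' \<Longrightarrow> lift k t \<rightarrow>* lift k t'"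
proof (induction rule: rtranclp_induct)
  case (step a b)
  have "lift k a \<rightarrow>* lift k b"
    using step.hyps(2)
  proof (induction arbitrary: k rule: beta_pi_induct)
    case (beta t u v)
    then show ?case using beta_step[of "lift (Suc k) t" "lift k u" "lift (Suc k) v"]
      by (simp add: lift_subst r_into_rtranclp)
  next
    case (pi t R S)
    then show ?case by (simp add: lift_append_arg pi_step r_into_rtranclp)
  qed (auto intro: steps_Lam steps_App)
  with step.IH show ?case by (rule rtranclp_trans)
qed simp

text \<open>The sides can differ only where an application replaces a head variable; there the left
  side has a \<open>\<pi>\<close>-redex that one step contracts.\<close>

lemma steps_subst_appl:
  "subst s k (appl t S) \<rightarrow>* appl (subst s k t) (subst_arg s k S)"
proof (induction t arbitrary: s k S rule: trm_induct)
  case (Var i)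
  then show ?case using App_steps_appl[of "subst s k (Var i)"] by simp
next
  case (App t u v)
  show ?case
    using App.IH(3)[of "lift 0 s" "Suc k" "lift_arg 0 S"]
    by (auto simp: lift_arg_subst_arg_le App_steps_appl intro: steps_App)
qed auto

text \<open>A \<open>\<beta>\<close>-redex survives because \<open>S\<close> moves into its
  continuation; after contraction \<open>S\<close>, being lifted, is untouched by the substitution
  and can be moved out again. A \<open>\<pi>\<close>-redex survives by associativity of
  append.\<close>

lemma step_appl_left:
  assumes "t \<rightarrow>\<^sub>\<beta>\<^sub>\<pi> t'"
  shows "appl t S \<rightarrow>* appl t' S"
  using assms
proof (induction arbitrary: S rule: beta_pi_induct)
  case (beta t u v)
  have "appl (App (Lam t) (GArg u v)) S \<rightarrow>* subst (subst u 0 t) 0 (appl v (lift_arg 0 S))"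
    using beta_step by auto
  also have "\<dots> \<rightarrow>* appl (subst (subst u 0 t) 0 v) S"
    using steps_subst_appl[of _ 0 v "lift_arg 0 S"] by (simp add: subst_arg_lift_arg)
  finally show ?case .
next
  case (pi t R T)
  then show ?case by (simp add: append_arg_assoc pi_step r_into_rtranclp)
next
  case (Lam t t')
  then show ?case by (cases S) (auto intro!: steps_App steps_Lam)
next
  case (App_fun t t' u v)
  then show ?case by (cases S) (auto intro!: steps_App)
qed (auto intro!: steps_App)

lemma steps_appl:
  assumes "t \<rightarrow>* t'" "u \<rightarrow>* u'" "v \<rightarrow>* v'"
  shows "appl t (GArg u v) \<rightarrow>* appl t' (GArg u' v')"
proof -
  have "appl t (GArg u v) \<rightarrow>* appl t' (GArg u v)"
    using assms(1)
    by (induction rule: rtranclp_induct) (auto dest: step_appl_left intro: rtranclp_trans)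
  \<comment> \<open>The argument ends up in the innermost continuation of \<open>t'\<close>, so the
    induction descends there with lifted \<open>u\<close> and \<open>v\<close>.\<close>
  also have "\<dots> \<rightarrow>* appl t' (GArg u' v')"
    using assms(2,3)
  proof (induction t' arbitrary: u u' v v' rule: trm_induct)
    case (App a b c)
    then show ?case by (simp add: steps_App steps_lift)
  qed (simp_all add: steps_App)
  finally show ?thesis .
qed

text \<open>A \<open>\<pi>\<close>-step becomes an equality of normal forms; a
  \<open>\<beta>\<close>-step is simulated by a \<open>\<beta>\<close>-step followed by
  normalisation.\<close>

lemma step_nf_subst:
  assumes "t \<rightarrow>\<^sub>\<beta>\<^sub>\<pi> t'"
  shows "nf (subst s k t) \<rightarrow>* nf (subst s k t')"
  using assms
proof (induction arbitrary: s k rule: beta_pi_induct)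
  case (beta t u v)
  let ?t = "subst (lift 0 s) (Suc k) t" and ?u = "subst s k u" and ?v = "subst (lift 0 s) (Suc k) v"
  have "nf (subst s k (App (Lam t) (GArg u v))) \<rightarrow>* nf (subst (subst (nf ?u) 0 (nf ?t)) 0 (nf ?v))"
    using contract_steps by simp
  \<comment> \<open>An \<open>nf\<close> is inserted around the inner substitution so that the
    absorption lemmas can then erase the ones on \<open>?u\<close> and \<open>?t\<close>.\<close>
  also have "\<dots> = nf (subst (nf (subst (nf ?u) 0 (nf ?t))) 0 ?v)"
    by (simp only: nf_subst_nf_right[of _ 0 ?v] nf_subst_nf_left[of "subst (nf ?u) 0 (nf ?t)"])
  also have "\<dots> = nf (subst (subst ?u 0 ?t) 0 ?v)"
    by (simp only: nf_subst_nf_left nf_subst_nf_right)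
  also have "\<dots> = nf (subst s k (subst (subst u 0 t) 0 v))"
    by (simp add: subst_subst)
  finally show ?case .
next
  case (pi t R S)
  have "nf (subst s k (App t (append_arg R S))) = nf (subst s k (appl (App t R) S))"
    by simp
  also have "\<dots> = nf (subst s k (App (App t R) S))"
    by (simp only: nf_subst_appl nf.simps subst.simps)
  finally show ?case by simp
qed (auto intro: steps_Lam steps_appl)

lemma steps_nf_subst:
  assumes "t \<rightarrow>* t'" "s \<rightarrow>* s'"
  shows "nf (subst s k t) \<rightarrow>* nf (subst s' k t')"
proof -
  have mono: "nf (subst s k t) \<rightarrow>* nf (subst s k t')" if "t \<rightarrow>* t'" for s k t t'
    using that
    by (induction rule: rtranclp_induct) (auto dest: step_nf_subst intro: rtranclp_trans)
  \<comment> \<open>Substituting into a lifted term gives back the original, so \<open>mono\<close>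
    specialises to monotonicity of \<open>nf\<close>.\<close>
  have "nf s \<rightarrow>* nf s'" if "s \<rightarrow>* s'" for s s'
    using mono[OF steps_lift[OF that], of s 0 0] by (simp add: subst_lift)
  then have "nf (subst s k t) \<rightarrow>* nf (subst s' k t)"
    using assms(2)
    by (induction t arbitrary: s s' k rule: trm_induct)
      (simp_all add: steps_Lam steps_appl steps_lift)
  also have "\<dots> \<rightarrow>* nf (subst s' k t')" using assms(1) by (rule mono)
  finally show ?thesis .
qed


section \<open>The Z property\<close>

text \<open>If \<open>star (App t R)\<close> happens to be an abstraction, \<open>appl\<close>
  leaves the newly created \<open>\<beta>\<close>-redex uncontracted.\<close>

fun star :: "trm \<Rightarrow> trm" where
  "star (Var i) = Var i"
| "star (Lam t) = Lam (star t)"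
| "star (App (Lam t) (GArg u v)) = nf (subst (subst (star u) 0 (star t)) 0 (star v))"
| "star (App (Var i) (GArg u v)) = App (Var i) (GArg (star u) (star v))"
| "star (App (App t R) (GArg u v)) = appl (star (App t R)) (GArg (star u) (star v))"

lemma lift_star: "lift k (star t) = star (lift k t)"
proof (induction t arbitrary: k rule: star.induct)
  case (5 t R u v)
  then show ?case by (simp add: lift_appl)
qed (simp_all add: lift_nf lift_subst)

lemma nf_star: "nf (star t) = star t"
  by (induction t rule: star.induct) (simp_all add: nf_appl)

text \<open>Both sides agree unless \<open>t\<close> is an abstraction, in which case the left side
  is the redex whose contraction is on the right.\<close>

lemma appl_star_steps:
  "appl (star t) (GArg (star u) (star v)) \<rightarrow>* star (App t (GArg u v))"
proof (cases t)
  case (Lam a)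
  then show ?thesis
    using contract_steps by simp
qed auto

lemma steps_star_App:
  assumes "t' \<rightarrow>* star t" "u' \<rightarrow>* star u" "v' \<rightarrow>* star v"
  shows "App t' (GArg u' v') \<rightarrow>* star (App t (GArg u v))"
proof -
  have "App t' (GArg u' v') \<rightarrow>* App (star t) (GArg (star u) (star v))"
    using assms by (rule steps_App)
  also note App_steps_appl
  also note appl_star_steps
  finally show ?thesis .
qed

lemma steps_star: "t \<rightarrow>* star t"
  by (induction t rule: trm_induct) (auto intro: steps_Lam steps_star_App)

text \<open>Appending can place an argument next to an abstraction inside a continuation. The right
  side contracts this new redex, whereas the left side may still contain it.\<close>

lemma appl_star_steps_star_appl:
  "appl (star t) (GArg (star p) (star q)) \<rightarrow>* star (appl t (GArg p q))"
proof (induction t arbitrary: p q rule: star.induct)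
  case (2 t)
  show ?case using appl_star_steps[of "Lam t"] by simp
next
  case (3 t u v)
  let ?w = "subst (star u) 0 (star t)"
    and ?p = "lift 0 p" and ?q = "lift (Suc 0) q"
  have "appl (star (App (Lam t) (GArg u v))) (GArg (star p) (star q))
    = nf (subst ?w 0 (appl (star v) (lift_arg 0 (GArg (star p) (star q)))))"
    by (simp add: nf_subst_appl subst_lift nf_star)
  also have "\<dots> \<rightarrow>* nf (subst ?w 0 (star (appl v (GArg ?p ?q))))"
    using 3(3)[of ?p ?q] by (intro steps_nf_subst) (simp_all add: lift_star)
  finally show ?case by simp
next
  case (4 i u v)
  then show ?case by (auto simp: lift_star intro: steps_App)
next
  case (5 t R u v)
  then show ?case by (simp add: appl_appl lift_star steps_appl)
qed auto

text \<open>Substitution can create \<open>\<beta>\<close>-redexes by putting an abstraction for a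
  head variable; only the right side contracts them.\<close>

lemma nf_subst_star_steps:
  "nf (subst (star s) k (star t)) \<rightarrow>* star (subst s k t)"
proof (induction t arbitrary: s k rule: star.induct)
  case (1 i)
  then show ?case by (simp add: nf_star)
next
  case (2 t)
  then show ?case by (simp add: lift_star steps_Lam)
next
  case (3 t u v)
  let ?s = "star s" and ?s' = "lift 0 (star s)"
  let ?t = "subst ?s' (Suc k) (star t)" and ?u = "subst ?s k (star u)"
    and ?v = "subst ?s' (Suc k) (star v)"
  let ?t' = "star (subst (lift 0 s) (Suc k) t)" and ?u' = "star (subst s k u)"
    and ?v' = "star (subst (lift 0 s) (Suc k) v)"
  have "nf (subst ?s k (star (App (Lam t) (GArg u v)))) = nf (subst (subst ?u 0 ?t) 0 ?v)"
    by (simp add: nf_subst_nf_right subst_subst)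
  \<comment> \<open>The induction hypotheses concern normalised substitutions, hence the inserted
    \<open>nf\<close>.\<close>
  also have "\<dots> = nf (subst (nf (subst (nf ?u) 0 (nf ?t))) 0 (nf ?v))"
    by (simp only: nf_subst_nf_left nf_subst_nf_right)
  also have "\<dots> \<rightarrow>* nf (subst (nf (subst ?u' 0 ?t')) 0 ?v')"
    using 3 by (intro steps_nf_subst) (simp_all add: lift_star)
  also have "\<dots> = star (subst s k (App (Lam t) (GArg u v)))"
    by (simp add: nf_subst_nf_left)
  finally show ?case .
next
  case (4 i u v)
  have "nf (subst (star s) k (star (App (Var i) (GArg u v))))
    \<rightarrow>* appl (star (subst s k (Var i))) (GArg (star (subst s k u)) (star (subst (lift 0 s) (Suc k) v)))"
    using 4 by (simp add: lift_star nf_star steps_App steps_appl)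
  \<comment> \<open>For \<open>i = k\<close> and \<open>s\<close> an abstraction, this contracts the
    redex created at the head.\<close>
  also note appl_star_steps
  finally show ?case by simp
next
  case (5 t R u v)
  have "nf (subst (star s) k (star (App (App t R) (GArg u v))))
    \<rightarrow>* appl (star (subst s k (App t R))) (GArg (star (subst s k u)) (star (subst (lift 0 s) (Suc k) v)))"
    using 5 unfolding star.simps nf_subst_appl subst_arg.simps nf_arg.simps lift_star
    by (intro steps_appl) auto
  also note appl_star_steps
  finally show ?case by simp
qed

lemma steps_Lam_inv: "Lam t \<rightarrow>* t' \<Longrightarrow> \<exists>t''. t' = Lam t'' \<and> t \<rightarrow>* t''"
proof (induction rule: rtranclp_induct)
  case (step a b)
  then obtain c where c: "a = Lam c" "t \<rightarrow>* c" by blast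
  with step.hyps(2) obtain d where "b = Lam d" "c \<rightarrow>\<^sub>\<beta>\<^sub>\<pi> d"
    unfolding beta_pi_def
    by (auto elim: compatible_closure.cases beta_root.cases pi_root.cases)
  with c(2) show ?case by auto
qed simp

text \<open>If \<open>t\<close> is an abstraction, so is \<open>t'\<close>, and both sides contract
  the head redex. Otherwise the left side is an \<open>appl\<close>, and a redex created by passing
  to \<open>t'\<close> is contracted at the end.\<close>

lemma star_App_mono:
  assumes "t \<rightarrow>\<^sub>\<beta>\<^sub>\<pi> t' \<or> t = t'" "star t \<rightarrow>* star t'" "star u \<rightarrow>* star u'" "star v \<rightarrow>* star v'"
  shows "star (App t (GArg u v)) \<rightarrow>* star (App t' (GArg u' v'))"
proof (cases "\<exists>a. t = Lam a")
  case True
  then obtain a where a: "t = Lam a" by blast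
  then obtain b where b: "t' = Lam b"
    using steps_Lam_inv[of a t'] assms(1) by auto
  have "star a \<rightarrow>* star b"
    using steps_Lam_inv[of "star a" "star t'"] assms(2) by (auto simp: a b)
  then have "nf (subst (nf (subst (star u) 0 (star a))) 0 (star v))
    \<rightarrow>* nf (subst (nf (subst (star u') 0 (star b))) 0 (star v'))"
    using assms(3,4) by (intro steps_nf_subst)
  then show ?thesis by (simp add: a b nf_subst_nf_left)
next
  case False
  then have "star (App t (GArg u v)) = appl (star t) (GArg (star u) (star v))"
    by (cases t) auto
  also have "\<dots> \<rightarrow>* appl (star t') (GArg (star u') (star v'))"
    using assms(2-4) by (rule steps_appl)
  also note appl_star_steps
  finally show ?thesis .
qed

text \<open>A root \<open>\<beta>\<close>-step uses the substitution comparison twice, once for each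
  nested substitution; a root \<open>\<pi>\<close>-step is the comparison for
  \<open>appl\<close>.\<close>

lemma star_mono: "t \<rightarrow>\<^sub>\<beta>\<^sub>\<pi> t' \<Longrightarrow> star t \<rightarrow>* star t'"
proof (induction rule: beta_pi_induct)
  case (beta t u v)
  have "star (App (Lam t) (GArg u v)) = nf (subst (nf (subst (star u) 0 (star t))) 0 (star v))"
    by (simp add: nf_subst_nf_left)
  also have "\<dots> \<rightarrow>* nf (subst (star (subst u 0 t)) 0 (star v))"
    by (intro steps_nf_subst nf_subst_star_steps rtranclp.rtrancl_refl)
  also note nf_subst_star_steps
  finally show ?case .
next
  case (pi t R S)
  obtain p q where "S = GArg p q" by (cases S)
  then show ?case using appl_star_steps_star_appl[of "App t R" p q] by simp
qed (auto intro: steps_Lam star_App_mono)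

lemma step_to_star: "t \<rightarrow>\<^sub>\<beta>\<^sub>\<pi> t' \<Longrightarrow> t' \<rightarrow>* star t"
proof (induction rule: beta_pi_induct)
  case (beta t u v)
  have "subst (subst u 0 t) 0 v \<rightarrow>* nf (subst (subst u 0 t) 0 v)" by (rule steps_nf)
  also have "\<dots> = nf (subst (nf (subst u 0 t)) 0 v)" by (simp add: nf_subst_nf_left)
  also have "\<dots> \<rightarrow>* nf (subst (nf (subst (star u) 0 (star t))) 0 (star v))"
    by (intro steps_nf_subst steps_star)
  also have "\<dots> = star (App (Lam t) (GArg u v))" by (simp add: nf_subst_nf_left)
  finally show ?case .
next
  case (pi t R S)
  obtain p q where S: "S = GArg p q" by (cases S)
  \<comment> \<open>The left side is the \<open>\<pi>\<close>-contractum, and the right side is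
    \<open>star\<close> of the \<open>\<pi>\<close>-redex.\<close>
  have "appl (App t R) S \<rightarrow>* appl (star (App t R)) (GArg (star p) (star q))"
    unfolding S by (intro steps_appl steps_star)
  then show ?case by (simp add: S)
qed (auto intro: steps_Lam steps_star_App steps_star)

theorem theorem3p2:
  shows "confluentp beta_pi"
  by (rule Z_imp_confluentp[where f = star]) (simp add: step_to_star star_mono)

end
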